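(* Let $\kappa$ be a cardinal number such that $\mathfrak c\le\kappa\le 2^{\mathfrak c}$, and let $\mathcal{SZ}\subset\mathbb R^{\mathbb R}$ be the set of Sierpiński–Zygmund functions. The following are equivalent: \begin{enumerate} \item $\mathcal{SZ}$ is strongly $\kappa$-algebrable. \item $\mathcal{SZ}$ is $\kappa$-algebrable. \item $\mathcal{SZ}$ is $\kappa$-lineable. \item There exists in $\mathfrak c$ an almost disjoint family of cardinality $\kappa$. \end{enumerate}
   Context: Here $\mathfrak c=2^{\aleph_0}$ is the cardinality of the continuum, and $\mathbb R^{\mathbb R}$ is the set of all functions $\mathbb R\to\mathbb R$, regarded as a real vector space and a commutative real algebra under pointwise operations. A function $f\colon\mathbb R\to\mathbb R$ is a Sierpiński–Zygmund function if for every set $Z\subset\mathbb R$ of cardinality $\mathfrak c$ the restriction $f\vert_Z$ is not a Borel map (in particular, not continuous). $\mathcal{SZ}$ denotes the set of all Sierpiński–Zygmund functions. A subset $M$ of a vector space is $\mu$-lineable if $M\cup\{0\}$ contains a vector subspace of dimension $\mu$. A subset $A$ of an algebra $\mathcal L$ is $\beta$-algebrable if there is a subalgebra $\mathcal B\subset\mathcal L$ with $\mathcal B\subset A\cup\{0\}$ such that $\mathcal B$ has a minimal system of generators $Z$ of cardinality $\beta$. A subset $E$ of a commutative algebra $B$ is strongly $\kappa$-algebrable if $E\cup\{0\}$ contains a $\kappa$-generated free algebra, i.e. a subalgebra $A\subset E\cup\{0\}$ generated by a set $X$ of cardinality $\kappa$ of free generators: for all distinct $x_1,\dots,x_n\in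 X$ and every nonzero real polynomial $P$ in $n$ variables without constant term, $P(x_1,\dots,x_n)\neq 0$. Algebras and subalgebras are not required to contain a unit. For a set $S$ of cardinality $\lambda$, a family $\mathcal F\subset\mathcal P(S)$ is an almost disjoint family in $S$ if every $A\in\mathcal F$ has cardinality $\lambda$ and any two distinct $A,B\in\mathcal F$ satisfy $\operatorname{card}(A\cap B)<\lambda$. "In $\mathfrak c$" means that $S$ is the cardinal $\mathfrak c$ (so $\lambda=\mathfrak c$). *)

theory Defs
  imports
    "HOL-Analysis.Borel_Space"
    "HOL-Library.Function_Algebras"
    "HOL-Library.Poly_Mapping"
begin

unbundle cardinal_syntax

instantiation "fun" :: (type, real_vector) real_vector
begin

definition scaleR_fun :: "real \<Rightarrow> ('a \<Rightarrow> 'b) \<Rightarrow> 'a \<Rightarrow> 'b"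
  where "scaleR_fun c f = (\<lambda>x. c *\<^sub>R f x)"

instance
  by standard (simp_all add: scaleR_fun_def fun_eq_iff algebra_simps)

end

instance "fun" :: (type, real_algebra) real_algebra
  by standard (simp_all add: scaleR_fun_def fun_eq_iff)

instance "fun" :: (type, real_algebra_1) real_algebra_1 ..


abbreviation continuum :: "real rel"
  where "continuum \<equiv> |UNIV :: real set|"

text \<open>The Borel structure on \<open>Z\<close> is the trace of the one on \<open>\<real>\<close>; \<open>Z\<close> itself need not be Borel.\<close>

definition Sierpinski_Zygmund :: "(real \<Rightarrow> real) set"
  where "Sierpinski_Zygmund =
    {f. \<forall>Z :: real set. |Z| =o continuum \<longrightarrow> f \<notin> borel_measurable (restrict_space borel Z)}"


definition has_dimension :: "'a::real_vector set \<Rightarrow> 'k rel \<Rightarrow> bool"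
  where "has_dimension V \<mu> \<longleftrightarrow> (\<exists>B. independent B \<and> span B = V \<and> |B| =o \<mu>)"

definition lineable :: "'k rel \<Rightarrow> 'a::real_vector set \<Rightarrow> bool"
  where "lineable \<mu> M \<longleftrightarrow> (\<exists>V. subspace V \<and> V \<subseteq> M \<union> {0} \<and> has_dimension V \<mu>)"


text \<open>Subalgebras need not contain the unit of the ambient algebra.\<close>

definition real_subalgebra :: "'a::real_algebra set \<Rightarrow> bool"
  where "real_subalgebra A \<longleftrightarrow> subspace A \<and> (\<forall>x\<in>A. \<forall>y\<in>A. x * y \<in> A)"

definition minimal_generators :: "'a::real_algebra set \<Rightarrow> 'a set \<Rightarrow> bool"
  where "minimal_generators Z A \<longleftrightarrow>
    real_subalgebra hull Z = A \<and> (\<forall>Z'. Z' \<subset> Z \<longrightarrow> real_subalgebra hull Z' \<noteq> A)"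

definition algebrable :: "'k rel \<Rightarrow> 'a::real_algebra set \<Rightarrow> bool"
  where "algebrable \<beta> E \<longleftrightarrow>
    (\<exists>A Z. real_subalgebra A \<and> A \<subseteq> E \<union> {0} \<and> minimal_generators Z A \<and> |Z| =o \<beta>)"

text \<open>
  Real polynomials in the variables \<open>0, \<dots>, n - 1\<close> are the finitely supported maps from monomials
  (finitely supported exponent maps) to coefficients whose monomials only involve indices below \<open>n\<close>.
  The unit of the ambient algebra enters the value only through the empty product, that is, through
  the constant term, the coefficient at the monomial \<open>0\<close>.
\<close>

definition polynomial_in :: "nat \<Rightarrow> ((nat \<Rightarrow>\<^sub>0 nat) \<Rightarrow>\<^sub>0 real) \<Rightarrow> bool"
  where "polynomial_in n P \<longleftrightarrow> (\<forall>m\<in>Poly_Mapping.keys P. Poly_Mapping.keys m \<subseteq> {..<n})"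

definition eval_polynomial ::
    "((nat \<Rightarrow>\<^sub>0 nat) \<Rightarrow>\<^sub>0 real) \<Rightarrow> (nat \<Rightarrow> 'a) \<Rightarrow> 'a::{real_algebra_1, comm_ring_1}"
  where "eval_polynomial P x =
    (\<Sum>m\<in>Poly_Mapping.keys P. Poly_Mapping.lookup P m *\<^sub>R
      (\<Prod>i\<in>Poly_Mapping.keys m. x i ^ Poly_Mapping.lookup m i))"

definition free_generators :: "'a::{real_algebra_1, comm_ring_1} set \<Rightarrow> bool"
  where "free_generators X \<longleftrightarrow>
    (\<forall>n x P. inj_on x {..<n} \<and> x ` {..<n} \<subseteq> X \<and>
       polynomial_in n P \<and> P \<noteq> 0 \<and> Poly_Mapping.lookup P 0 = 0 \<longrightarrow> eval_polynomial P x \<noteq> 0)"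

definition strongly_algebrable :: "'k rel \<Rightarrow> 'a::{real_algebra_1, comm_ring_1} set \<Rightarrow> bool"
  where "strongly_algebrable \<kappa> E \<longleftrightarrow>
    (\<exists>A X. real_subalgebra A \<and> A \<subseteq> E \<union> {0} \<and>
       real_subalgebra hull X = A \<and> |X| =o \<kappa> \<and> free_generators X)"


definition almost_disjoint_family :: "'a set \<Rightarrow> 'a set set \<Rightarrow> bool"
  where "almost_disjoint_family S F \<longleftrightarrow>
    F \<subseteq> Pow S \<and> (\<forall>A\<in>F. |A| =o |S| ) \<and> (\<forall>A\<in>F. \<forall>B\<in>F. A \<noteq> B \<longrightarrow> |A \<inter> B| <o |S| )"

end

theory Submission
  imports Defs
    "HOL-Library.Multiset"
    "HOL-Computational_Algebra.Polynomial"
    "HOL-Analysis.Abstract_Topology_2"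
begin

text \<open>
  Write \<open>SZ\<close> for the set of Sierpinski-Zygmund functions and \<open>c\<close> for the cardinality of the continuum.
  Each of the three algebraic properties supplies a linear subspace of functions, contained in
  \<open>SZ \<union> {0}\<close>, together with \<open>\<kappa>\<close> of its elements. If \<open>f \<noteq> g\<close> lie in such a subspace, then \<open>f - g\<close>
  is a Sierpinski-Zygmund function, and it vanishes where \<open>f\<close> and \<open>g\<close> agree; as the zero function
  is Borel, \<open>f\<close> and \<open>g\<close> agree at fewer than \<open>c\<close> points. Hence the graphs form an almost disjoint
  family in the plane, a set of cardinality \<open>c\<close> (\<open>almost_disjoint_graphs\<close>).

  Conversely, let \<open>F\<close> be an almost disjoint family of \<open>\<kappa>\<close> sets of reals. There are only \<open>c\<close> many
  Borel sets, so a family \<open>g \<eta>\<close> of functions, indexed by the reals, contains an extension of every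
  partial Borel function (\<open>ex_universal_partial_borel\<close>). Well-order the reals in type \<open>c\<close>. Fewer
  than \<open>c\<close> reals precede a given \<open>\<xi>\<close>, so there is a set \<open>T \<xi>\<close> of size \<open>c\<close> that is algebraically
  independent over the values \<open>g \<eta> \<xi>\<close> and the reals \<open>\<eta>\<close> with \<open>\<eta> \<le> \<xi>\<close>
  (\<open>ex_algebraically_independent_over\<close>). With bijections \<open>h A\<close> from the reals onto \<open>A \<in> F\<close>
  and \<open>t \<xi>\<close> from the reals onto \<open>T \<xi>\<close>, put \<open>f A \<xi> = t \<xi> (h A \<xi>)\<close>.

  Take a nonzero polynomial \<open>P\<close> without constant term, distinct \<open>A\<^sub>1, \<dots>, A\<^sub>n \<in> F\<close> and an index
  \<open>\<eta>\<close>. For all but fewer than \<open>c\<close> many \<open>\<xi>\<close>, both \<open>\<eta>\<close> and the coefficients of \<open>P\<close> are at most \<open>\<xi>\<close>,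
  and the reals \<open>h A\<^sub>i \<xi>\<close> are distinct, the latter because \<open>h A\<^sub>i\<close> maps the \<open>\<xi>\<close> with \<open>h A\<^sub>i \<xi> = h A\<^sub>j \<xi>\<close>
  injectively into the small set \<open>A\<^sub>i \<inter> A\<^sub>j\<close>. For such \<open>\<xi>\<close> the \<open>f A\<^sub>i \<xi>\<close> are distinct elements of \<open>T \<xi>\<close>, so
  \<open>P (f A\<^sub>1, \<dots>, f A\<^sub>n)\<close> cannot take the value \<open>g \<eta> \<xi>\<close> there. Thus it agrees with no partial Borel
  function on a set of size \<open>c\<close> and belongs to \<open>SZ\<close>
  (\<open>ex_polynomials_in_Sierpinski_Zygmund\<close>). This makes the functions \<open>f A\<close> free generators of an
  algebra inside \<open>SZ \<union> {0}\<close>. The monomials in them are linearly independent, so they are also a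
  minimal system of generators and a basis of their span.
\<close>

section \<open>Continuum many functions suffice to represent all partial Borel functions\<close>

text \<open>
  Codes for the members of the \<open>\<sigma>\<close>-algebra generated by countably many sets. The single operation
  \<open>Co_Union\<close>, the complement of a countable union, produces both complements and countable unions.
\<close>

datatype borel_code = Basic nat | Co_Union "nat \<Rightarrow> borel_code"

primrec decode :: "(nat \<Rightarrow> 'a set) \<Rightarrow> borel_code \<Rightarrow> 'a set"
  where
    "decode G (Basic n) = G n"
  | "decode G (Co_Union s) = - (\<Union>i. decode G (s i))"

text \<open>
  A code is a well-founded tree with countable branching; \<open>label a\<close> reads off its nodes along finite
  paths. This bounds the number of codes by that of functions from a countable set to \<open>\<nat>\<close>, with no
  transfinite iteration through the Borel hierarchy.
\<close>

primrec label :: "borel_code \<Rightarrow> nat list \<Rightarrow> nat"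
  where
    "label (Basic n) = (\<lambda>p. Suc n)"
  | "label (Co_Union s) = (\<lambda>p. case p of [] \<Rightarrow> 0 | k # q \<Rightarrow> label (s k) q)"

lemma inj_label: "inj label"
proof (rule injI)
  fix a b assume "label a = label b"
  then show "a = b"
  proof (induction a arbitrary: b)
    case (Basic n)
    then show ?case
      by (cases b) (auto simp: fun_eq_iff dest: spec[of _ "[]"])
  next
    case (Co_Union s)
    show ?case
    proof (cases b)
      case (Basic n)
      then show ?thesis
        using Co_Union.prems by (auto simp: fun_eq_iff dest: spec[of _ "[]"])
    next
      case b: (Co_Union t)
      have "label (s k) = label (t k)" for k
      proof
        fix q show "label (s k) q = label (t k) q"
          using fun_cong[OF Co_Union.prems, of "k # q"] b by simp
      qed
      then have "s k = t k" for k
        using Co_Union.IH by blast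
      then show ?thesis using b by auto
    qed
  qed
qed

lemma sigma_sets_subset_range_decode: "sigma_sets UNIV (range G) \<subseteq> range (decode G)"
proof
  fix A assume "A \<in> sigma_sets UNIV (range G)"
  then show "A \<in> range (decode G)"
  proof induction
    case (Basic A)
    then show ?case by (metis decode.simps(1) imageE rangeI)
  next
    case Empty
    \<comment> \<open>the union of \<open>G 0\<close> and its complement is everything\<close>
    let ?s = "\<lambda>i :: nat. if i = 0 then Basic 0 else Co_Union (\<lambda>_. Basic 0)"
    have "x \<in> decode G (?s 0) \<union> decode G (?s 1)" for x by simp
    then have "decode G (Co_Union ?s) = {}" unfolding decode.simps(2) by blast
    then show ?case by (rule range_eqI[OF sym])
  next
    case (Compl A)
    then obtain a where "A = decode G a" by blast
    then have "UNIV - A = decode G (Co_Union (\<lambda>_. a))" by auto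
    then show ?case by (rule range_eqI)
  next
    case (Union A)
    then have "\<forall>i. \<exists>a. A i = decode G a" by (simp add: image_iff)
    then obtain s where "\<forall>i. A i = decode G (s i)" by (rule choice[THEN exE])
    then have "(\<Union>i. A i) = decode G (Co_Union (\<lambda>_. Co_Union s))" by auto
    then show ?case by (rule range_eqI)
  qed
qed

text \<open>
  Sequences of codes inject into the power set of \<open>\<nat>\<close>, which is equipotent with the reals: a
  sequence of labelled trees is determined by the graph of a function on a countable set.
\<close>

lemma ex_surj_real_code_sequences: "\<exists>d :: real \<Rightarrow> rat \<Rightarrow> borel_code. surj d"
proof -
  define e :: "(rat \<Rightarrow> borel_code) \<Rightarrow> nat set"
    where "e s = {to_nat (q, p, label (s q) p) | q p. True}" for s
  have "inj e"
  proof (rule injI)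
    fix s t assume "e s = e t"
    have "label (s q) p = label (t q) p" for q p
    proof -
      have "to_nat (q, p, label (s q) p) \<in> e t"
        unfolding \<open>e s = e t\<close>[symmetric] by (auto simp: e_def)
      then show ?thesis
        by (auto simp: e_def)
    qed
    then have "label (s q) = label (t q)" for q by blast
    then show "s = t" using inj_label by (auto simp: inj_def)
  qed
  moreover obtain b :: "nat set \<Rightarrow> real" where "bij b"
    using nat_sets_eqpoll_reals by (auto simp: eqpoll_def)
  ultimately have "inj (b \<circ> e)"
    by (simp add: bij_is_inj inj_compose)
  then show ?thesis
    by (meson inj_imp_surj_inv)
qed

text \<open>
  A real function \<open>f\<close> on \<open>Z\<close> is recovered from its sublevel sets at the rationals, since \<open>f z\<close> is the
  infimum of the rationals above it. If \<open>f\<close> is Borel, these sublevel sets are traces of Borel sets,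
  so a sequence of codes determines \<open>f\<close>. The same infimum defines the total functions \<open>g \<eta>\<close>,
  one for each sequence of codes, and of these there are only continuum many.
\<close>

lemma ex_universal_partial_borel:
  "\<exists>g :: real \<Rightarrow> real \<Rightarrow> real.
     \<forall>Z f. f \<in> borel_measurable (restrict_space borel Z) \<longrightarrow> (\<exists>\<eta>. \<forall>z\<in>Z. f z = g \<eta> z)"
proof -
  obtain \<B> :: "real set set" where \<B>: "countable \<B>" "topological_basis \<B>"
    using ex_countable_basis by blast
  have "\<B> \<noteq> {}"
    using topological_basisE[OF \<B>(2) open_UNIV UNIV_I] by blast
  define G where "G = from_nat_into \<B>"
  then have G: "range G = \<B>"
    using \<open>\<B> \<noteq> {}\<close> \<B>(1) by (simp add: range_from_nat_into)
  obtain d :: "real \<Rightarrow> rat \<Rightarrow> borel_code" where d: "surj d"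
    using ex_surj_real_code_sequences by blast
  define g where "g \<eta> z = Inf (real_of_rat ` {q. z \<in> decode G (d \<eta> q)})" for \<eta> z :: real
  have "\<exists>\<eta>. \<forall>z\<in>Z. f z = g \<eta> z" if f: "f \<in> borel_measurable (restrict_space borel Z)" for Z f
  proof -
    have "\<exists>a. f -` {..<real_of_rat q} \<inter> Z = decode G a \<inter> Z" for q
    proof -
      have "f -` {..<real_of_rat q} \<inter> space (restrict_space borel Z) \<in> sets (restrict_space borel Z)"
        using f by (rule measurable_sets) simp
      then obtain B where "B \<in> sets borel" and B: "f -` {..<real_of_rat q} \<inter> Z = Z \<inter> B"
        by (auto simp: sets_restrict_space space_restrict_space)
      moreover have "sets borel = sigma_sets UNIV (range G)"
        unfolding G borel_eq_countable_basis[OF \<B>] by (rule sets_measure_of) simp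
      ultimately have "B \<in> range (decode G)"
        using sigma_sets_subset_range_decode[of G] by auto
      then obtain a where "B = decode G a" by (elim rangeE)
      then show ?thesis using B by (intro exI[of _ a]) (simp add: Int_commute)
    qed
    then obtain s where s: "\<And>q. f -` {..<real_of_rat q} \<inter> Z = decode G (s q) \<inter> Z"
      by metis
    obtain \<eta> where \<eta>: "d \<eta> = s" using d by (metis surjD)
    have "f z = g \<eta> z" if "z \<in> Z" for z
    proof -
      have "{q. z \<in> decode G (s q)} = {q. f z < of_rat q}"
        using s that by blast
      moreover have "Inf (real_of_rat ` {q. f z < of_rat q}) = f z"
      proof (rule cInf_eq_non_empty)
        show "real_of_rat ` {q. f z < of_rat q} \<noteq> {}"
          using of_rat_dense[of "f z" "f z + 1"] by auto
        show "y \<le> f z" if "\<And>x. x \<in> real_of_rat ` {q. f z < of_rat q} \<Longrightarrow> y \<le> x" for y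
        proof (rule ccontr)
          assume "\<not> y \<le> f z"
          then obtain q where "f z < of_rat q" "of_rat q < y"
            using of_rat_dense[of "f z" y] by auto
          then show False using that[of "of_rat q"] by auto
        qed
      qed auto
      ultimately show ?thesis by (simp add: g_def \<eta>)
    qed
    then show ?thesis by blast
  qed
  then show ?thesis by (intro exI[of _ g] allI impI)
qed

section \<open>Large algebraically independent sets\<close>

text \<open>
  A monomial is a multiset of variables, here elements of \<open>T\<close>, and its value is \<open>prod_mset\<close>. The sum
  is therefore the value at distinct elements of \<open>T\<close> of a nonzero polynomial, possibly constant,
  whose nonzero coefficients all lie in the set \<open>S\<close>.
\<close>

definition algebraically_independent_over :: "'a::field set \<Rightarrow> 'a set \<Rightarrow> bool"
  where "algebraically_independent_over S T \<longleftrightarrow>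
    (\<forall>M c. finite M \<and> M \<noteq> {} \<and> (\<forall>m\<in>M. set_mset m \<subseteq> T \<and> c m \<in> S \<and> c m \<noteq> 0) \<longrightarrow>
       (\<Sum>m\<in>M. c m * prod_mset m) \<noteq> 0)"

lemma card_of_finite_ordLess_infinite: "finite A \<Longrightarrow> infinite B \<Longrightarrow> |A| <o |B|"
  by (meson card_of_Well_order card_of_ordLeq_finite ordLess_or_ordLeq)

lemmas card_of_finite_ordLeq_infinite = ordLess_imp_ordLeq[OF card_of_finite_ordLess_infinite]

lemma card_of_lists_ordLeq:
  assumes "infinite B" and A: "|A| \<le>o |B|"
  shows "|lists A| \<le>o |B|"
proof -
  have "|{xs \<in> lists A. length xs = n}| \<le>o |B|" for n
  proof (induction n)
    case 0
    have "{xs \<in> lists A. length xs = 0} = {[]}" by auto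
    then show ?case
      using assms(1) by (simp add: card_of_finite_ordLeq_infinite)
  next
    case (Suc n)
    have "{xs \<in> lists A. length xs = Suc n} \<subseteq>
        (\<lambda>(x, xs). x # xs) ` (A \<times> {xs \<in> lists A. length xs = n})"
      by (force simp: length_Suc_conv)
    then have "|{xs \<in> lists A. length xs = Suc n}| \<le>o |A \<times> {xs \<in> lists A. length xs = n}|"
      by (rule ordLeq_transitive[OF card_of_mono1 card_of_image])
    also have "|A \<times> {xs \<in> lists A. length xs = n}| \<le>o |B|"
      using assms Suc
      by (intro card_of_Times_ordLeq_infinite_Field card_of_Card_order) (simp_all add: Field_card_of)
    finally show ?case .
  qed
  moreover have "|UNIV :: nat set| \<le>o |B|"
    using assms(1) infinite_iff_card_of_nat by blast
  ultimately have "|\<Union>n. {xs \<in> lists A. length xs = n}| \<le>o |B|"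
    by (intro card_of_UNION_ordLeq_infinite[OF assms(1)] ballI)
  moreover have "(\<Union>n. {xs \<in> lists A. length xs = n}) = lists A" by auto
  ultimately show ?thesis by simp
qed

text \<open>
  Sorting a polynomial in \<open>insert r T\<close> by powers of \<open>r\<close> turns it into a univariate polynomial
  evaluated at \<open>r\<close>. Its coefficients are polynomials in \<open>T\<close> over \<open>S\<close>, at least one of them nonzero by
  the independence of \<open>T\<close>. So \<open>r\<close> may be added unless it is a root of one of these univariate
  polynomials. Their coefficients are written as sums of products of lists over \<open>S \<union> T\<close>,
  which makes them easy to count.
\<close>

lemma algebraically_independent_over_insert:
  fixes S T :: "'a::field set"
  assumes T: "algebraically_independent_over S T"
    and r: "\<And>p. p \<noteq> 0 \<Longrightarrow>
      set (coeffs p) \<subseteq> (\<lambda>L. \<Sum>l\<leftarrow>L. prod_list l) ` lists (lists (S \<union> T)) \<Longrightarrow> poly p r \<noteq> 0"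
  shows "algebraically_independent_over S (insert r T)"
  unfolding algebraically_independent_over_def
proof (intro allI impI)
  fix M and c :: "'a multiset \<Rightarrow> 'a"
  assume *: "finite M \<and> M \<noteq> {} \<and> (\<forall>m\<in>M. set_mset m \<subseteq> insert r T \<and> c m \<in> S \<and> c m \<noteq> 0)"
  define rest where "rest m = filter_mset (\<lambda>x. x \<noteq> r) m" for m :: "'a multiset"
  define N where "N k = {m \<in> M. count m r = k}" for k
  define a where "a k = (\<Sum>m\<in>N k. c m * prod_mset (rest m))" for k
  define K where "K = (\<lambda>m. count m r) ` M"
  define p where "p = (\<Sum>k\<in>K. monom (a k) k)"
  have split: "m = replicate_mset (count m r) r + rest m" for m :: "'a multiset"
    unfolding rest_def filter_eq_replicate_mset[symmetric]
    by (metis multiset_partition)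
  have fin: "finite K" "finite (N k)" for k
    using * by (auto simp: K_def N_def)
  have coeff: "coeff p k = (if k \<in> K then a k else 0)" for k
    using fin by (simp add: p_def coeff_sum)
  have inj: "inj_on rest (N k)" for k
    by (rule inj_onI) (metis (mono_tags, lifting) N_def mem_Collect_eq split)
  have "a k \<noteq> 0" if "k \<in> K" for k
  proof -
    \<comment> \<open>within \<open>N k\<close> a monomial is determined by its part free of \<open>r\<close>\<close>
    define c' where "c' m = c (replicate_mset k r + m)" for m
    have c': "c' (rest m) = c m" if "m \<in> N k" for m
      using split[of m] that by (simp add: c'_def N_def)
    have "a k = (\<Sum>m\<in>rest ` N k. c' m * prod_mset m)"
      unfolding a_def by (subst sum.reindex[OF inj]) (simp add: c')
    also have "\<dots> \<noteq> 0"
    proof -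
      have "finite (rest ` N k)" "rest ` N k \<noteq> {}"
        using fin that by (auto simp: N_def K_def)
      moreover have "set_mset m \<subseteq> T \<and> c' m \<in> S \<and> c' m \<noteq> 0" if "m \<in> rest ` N k" for m
        using that * c' by (fastforce simp: rest_def N_def)
      ultimately show ?thesis
        using T unfolding algebraically_independent_over_def by blast
    qed
    finally show ?thesis .
  qed
  moreover obtain k where "k \<in> K" using * by (auto simp: K_def)
  ultimately have "p \<noteq> 0"
    by (metis coeff coeff_0)
  moreover have "set (coeffs p) \<subseteq> (\<lambda>L. \<Sum>l\<leftarrow>L. prod_list l) ` lists (lists (S \<union> T))"
  proof
    fix x assume "x \<in> set (coeffs p)"
    then have "x \<in> range (coeff p)" using range_coeff by blast
    then have "x = 0 \<or> x \<in> a ` K" by (auto simp: coeff split: if_splits)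
    then show "x \<in> (\<lambda>L. \<Sum>l\<leftarrow>L. prod_list l) ` lists (lists (S \<union> T))"
    proof
      assume "x = 0"
      then show ?thesis by (intro image_eqI[of _ _ "[]"]) auto
    next
      assume "x \<in> a ` K"
      then obtain k where k: "x = a k" by blast
      obtain ms where ms: "set ms = N k" "distinct ms"
        using fin finite_distinct_list by blast
      define ls where "ls m = (SOME l. mset l = rest m)" for m
      have ls: "mset (ls m) = rest m" for m
        unfolding ls_def by (rule someI_ex) (rule ex_mset)
      have "x = (\<Sum>l\<leftarrow>map (\<lambda>m. c m # ls m) ms. prod_list l)"
        unfolding k a_def ms(1)[symmetric] sum.distinct_set_conv_list[OF ms(2)]
        by (simp add: o_def prod_mset_prod_list[symmetric] ls)
      moreover have "map (\<lambda>m. c m # ls m) ms \<in> lists (lists (S \<union> T))"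
      proof -
        have "c m # ls m \<in> lists (S \<union> T)" if "m \<in> N k" for m
        proof -
          have "set (ls m) = set_mset (rest m)" using ls by (metis set_mset_mset)
          then show ?thesis using that * by (fastforce simp: rest_def N_def)
        qed
        then have "(\<lambda>m. c m # ls m) ` set ms \<subseteq> lists (S \<union> T)"
          unfolding ms(1) by (rule image_subsetI)
        then show ?thesis by (simp only: lists_eq_set mem_Collect_eq set_map)
      qed
      ultimately show ?thesis by blast
    qed
  qed
  ultimately have "poly p r \<noteq> 0" by (rule r)
  also have "poly p r = (\<Sum>k\<in>K. \<Sum>m\<in>N k. c m * prod_mset m)"
    unfolding p_def poly_sum poly_monom a_def sum_distrib_right
  proof (intro sum.cong refl)
    fix k m assume "m \<in> N k"
    then have "prod_mset m = r ^ k * prod_mset (rest m)"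
      by (subst split[of m]) (simp add: N_def)
    then show "c m * prod_mset (rest m) * r ^ k = c m * prod_mset m" by simp
  qed
  also have "\<dots> = (\<Sum>m\<in>M. c m * prod_mset m)"
    unfolding K_def N_def using * by (intro sum.image_gen[symmetric]) auto
  finally show "(\<Sum>m\<in>M. c m * prod_mset m) \<noteq> 0" .
qed

text \<open>
  A maximal independent set \<open>T\<close> has full size: by maximality every element of the field lies in \<open>T\<close>
  or is a root of a nonzero polynomial whose coefficients are sums of products from \<open>S \<union> T\<close>. As \<open>S\<close>
  is infinite, there are at most \<open>|S \<union> T|\<close> such roots, too few if \<open>T\<close> is smaller than the field.
\<close>

lemma ex_algebraically_independent_over:
  fixes S :: "'a::field set"
  assumes "infinite S" and S: "|S| <o |UNIV :: 'a set|"
  shows "\<exists>T. algebraically_independent_over S T \<and> |T| =o |UNIV :: 'a set|"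
proof -
  let ?\<A> = "{T. algebraically_independent_over S T}"
  have "\<exists>T\<in>?\<A>. \<forall>T'\<in>?\<A>. T \<subseteq> T' \<longrightarrow> T' = T"
  proof (rule subset_Zorn_nonempty)
    have "algebraically_independent_over S {}"
      unfolding algebraically_independent_over_def
    proof (intro allI impI)
      fix M and c :: "'a multiset \<Rightarrow> 'a"
      assume *: "finite M \<and> M \<noteq> {} \<and> (\<forall>m\<in>M. set_mset m \<subseteq> {} \<and> c m \<in> S \<and> c m \<noteq> 0)"
      then have "M = {{#}}" by auto
      then show "(\<Sum>m\<in>M. c m * prod_mset m) \<noteq> 0" using * by simp
    qed
    then show "?\<A> \<noteq> {}" by blast
  next
    fix \<C> assume "\<C> \<noteq> {}" and chain: "subset.chain ?\<A> \<C>"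
    have "algebraically_independent_over S (\<Union>\<C>)"
      unfolding algebraically_independent_over_def
    proof (intro allI impI)
      fix M and c :: "'a multiset \<Rightarrow> 'a"
      assume *: "finite M \<and> M \<noteq> {} \<and> (\<forall>m\<in>M. set_mset m \<subseteq> \<Union>\<C> \<and> c m \<in> S \<and> c m \<noteq> 0)"
      have "finite (\<Union>m\<in>M. set_mset m)" "(\<Union>m\<in>M. set_mset m) \<subseteq> \<Union>\<C>"
        using * by auto
      then obtain T where "T \<in> \<C>" "(\<Union>m\<in>M. set_mset m) \<subseteq> T"
        using finite_subset_Union_chain[OF _ _ \<open>\<C> \<noteq> {}\<close> chain] by metis
      moreover have "algebraically_independent_over S T"
        using chain \<open>T \<in> \<C>\<close> by (auto simp: subset.chain_def)
      moreover have "\<forall>m\<in>M. set_mset m \<subseteq> T \<and> c m \<in> S \<and> c m \<noteq> 0"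
        using * \<open>(\<Union>m\<in>M. set_mset m) \<subseteq> T\<close> by (simp add: UN_subset_iff)
      ultimately show "(\<Sum>m\<in>M. c m * prod_mset m) \<noteq> 0"
        using * unfolding algebraically_independent_over_def by metis
    qed
    then show "\<Union>\<C> \<in> ?\<A>" by simp
  qed
  then obtain T where T: "algebraically_independent_over S T"
    and max: "\<And>T'. algebraically_independent_over S T' \<Longrightarrow> T \<subseteq> T' \<Longrightarrow> T' = T"
    by auto
  have "|T| =o |UNIV :: 'a set|"
  proof (rule ccontr)
    assume "\<not> |T| =o |UNIV :: 'a set|"
    then have "|T| <o |UNIV :: 'a set|"
      by (meson card_of_mono1 ordLeq_iff_ordLess_or_ordIso subset_UNIV)
    moreover have "infinite (UNIV :: 'a set)"
      using assms(1) finite_subset[OF subset_UNIV] by blast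
    ultimately have W: "|S \<union> T| <o |UNIV :: 'a set|"
      by (intro card_of_Un_ordLess_infinite S)
    have inf: "infinite (S \<union> T)" using assms(1) by simp
    define V where "V = (\<lambda>L. \<Sum>l\<leftarrow>L. prod_list l) ` lists (lists (S \<union> T))"
    have "|lists (lists (S \<union> T))| \<le>o |S \<union> T|"
      by (intro card_of_lists_ordLeq inf ordIso_imp_ordLeq[OF card_of_refl])
    then have V: "|V| \<le>o |S \<union> T|"
      unfolding V_def by (rule ordLeq_transitive[OF card_of_image])
    define R where "R = (\<Union>p\<in>Poly ` lists V - {0}. {x. poly p x = 0})"
    have "|Poly ` lists V - {0}| \<le>o |lists V|"
      by (rule ordLeq_transitive[OF card_of_mono1[OF Diff_subset] card_of_image])
    also have "|lists V| \<le>o |S \<union> T|"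
      using inf V by (rule card_of_lists_ordLeq)
    finally have "|R| \<le>o |S \<union> T|"
      unfolding R_def using inf
      by (intro card_of_UNION_ordLeq_infinite ballI)
        (auto intro!: card_of_finite_ordLeq_infinite poly_roots_finite)
    moreover have "|T| \<le>o |S \<union> T|" by (simp add: card_of_mono1)
    ultimately have "|R \<union> T| \<le>o |S \<union> T|"
      using inf
      by (intro card_of_Un_ordLeq_infinite_Field card_of_Card_order) (simp_all add: Field_card_of)
    then have "R \<union> T \<noteq> UNIV"
      using not_ordLess_ordLeq[OF W] by (intro notI) simp
    then obtain r where r: "r \<notin> R" "r \<notin> T" by blast
    have "algebraically_independent_over S (insert r T)"
      using T
    proof (rule algebraically_independent_over_insert)
      fix p assume "p \<noteq> 0" "set (coeffs p) \<subseteq> (\<lambda>L. \<Sum>l\<leftarrow>L. prod_list l) ` lists (lists (S \<union> T))"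
      then have "p \<in> Poly ` lists V - {0}"
        unfolding V_def[symmetric] by (auto intro!: image_eqI[of _ _ "coeffs p"])
      then show "poly p r \<noteq> 0" using r by (auto simp: R_def)
    qed
    then show False using max[of "insert r T"] r by blast
  qed
  then show ?thesis using T by blast
qed

section \<open>Free generators and linearly independent monomials\<close>

lemma inj_on_image_mset:
  assumes "inj_on y B"
  shows "inj_on (image_mset y) {m. set_mset m \<subseteq> B}"
proof (rule inj_on_inverseI)
  fix m assume "m \<in> {m. set_mset m \<subseteq> B}"
  then have "image_mset (\<lambda>x. the_inv_into B y (y x)) m = image_mset id m"
    using assms by (intro image_mset_cong) (auto simp: the_inv_into_f_f)
  then show "image_mset (the_inv_into B y) (image_mset y m) = m"
    by (simp add: multiset.map_comp o_def)
qed

definition monomials :: "'a set \<Rightarrow> 'a multiset set"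
  where "monomials X = {m. m \<noteq> {#} \<and> set_mset m \<subseteq> X}"

lemma real_subalgebra_hull: "real_subalgebra (real_subalgebra hull X)"
  by (rule hull_in) (auto simp: real_subalgebra_def intro: subspace_Inter)

text \<open>
  The span of the monomials is closed under products because monomials are, by adding multisets.
\<close>

lemma hull_eq_span_monomials:
  fixes X :: "'a::{real_algebra_1, comm_ring_1} set"
  shows "real_subalgebra hull X = span (prod_mset ` monomials X)"
proof (rule hull_unique)
  show "X \<subseteq> span (prod_mset ` monomials X)"
  proof
    fix x assume "x \<in> X"
    then have "x \<in> prod_mset ` monomials X"
      by (intro image_eqI[of _ _ "{#x#}"]) (auto simp: monomials_def)
    then show "x \<in> span (prod_mset ` monomials X)" by (rule span_base)
  qed
  have "x * y \<in> span (prod_mset ` monomials X)"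
    if "x \<in> span (prod_mset ` monomials X)" "y \<in> span (prod_mset ` monomials X)" for x y
    using that(1)
  proof (induction rule: span_induct_alt)
    case base
    then show ?case by (simp add: span_zero)
  next
    case (step c a x)
    then obtain m where m: "m \<in> monomials X" "a = prod_mset m" by blast
    have "a * y \<in> span (prod_mset ` monomials X)"
      using that(2)
    proof (induction rule: span_induct_alt)
      case base
      then show ?case by (simp add: span_zero)
    next
      case (step d b y)
      then obtain m' where m': "m' \<in> monomials X" "b = prod_mset m'" by blast
      have "a * b \<in> prod_mset ` monomials X"
        using m m' by (intro image_eqI[of _ _ "m + m'"]) (auto simp: monomials_def)
      then show ?case
        using step.IH by (simp add: distrib_left span_add span_scale span_base)
    qed
    then show ?case
      using step.IH by (simp add: distrib_right span_add span_scale)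
  qed
  then show "real_subalgebra (span (prod_mset ` monomials X))"
    by (auto simp: real_subalgebra_def)
next
  fix A :: "'a set" assume "X \<subseteq> A" and A: "real_subalgebra A"
  have "prod_mset m \<in> A" if "m \<noteq> {#}" "set_mset m \<subseteq> X" for m
    using that
  proof (induction m)
    case empty
    then show ?case by simp
  next
    case (add x m)
    then have "x \<in> A" using \<open>X \<subseteq> A\<close> by auto
    then show ?case
      using add A by (cases "m = {#}") (simp_all add: real_subalgebra_def)
  qed
  then have "prod_mset ` monomials X \<subseteq> A" by (auto simp: monomials_def)
  then show "span (prod_mset ` monomials X) \<subseteq> A"
    using A by (intro span_minimal) (auto simp: real_subalgebra_def)
qed

text \<open>
  Every nonzero polynomial without constant term takes a value in \<open>E\<close> at distinct elements of \<open>X\<close>.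
  If \<open>E\<close> does not contain \<open>0\<close>, this says at once that \<open>X\<close> is free and that the algebra which it
  generates is contained in \<open>E \<union> {0}\<close>.
\<close>

definition nonzero_polynomials_in :: "'a::{real_algebra_1, comm_ring_1} set \<Rightarrow> 'a set \<Rightarrow> bool"
  where "nonzero_polynomials_in X E \<longleftrightarrow>
    (\<forall>M c. finite M \<and> M \<noteq> {} \<and> M \<subseteq> monomials X \<and> (\<forall>m\<in>M. c m \<noteq> 0) \<longrightarrow>
       (\<Sum>m\<in>M. c m *\<^sub>R prod_mset m) \<in> E)"

context
  fixes X E :: "'a::{real_algebra_1, comm_ring_1} set"
  assumes XE: "nonzero_polynomials_in X E" and zero: "0 \<notin> E"
begin

lemma polynomial_in_E:
  assumes "finite M" "M \<noteq> {}" "M \<subseteq> monomials X" "\<And>m. m \<in> M \<Longrightarrow> c m \<noteq> 0"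
  shows "(\<Sum>m\<in>M. c m *\<^sub>R prod_mset m) \<in> E"
  using XE assms unfolding nonzero_polynomials_in_def by simp

lemma inj_on_prod_mset_monomials: "inj_on prod_mset (monomials X)"
proof (rule inj_onI, rule ccontr)
  fix m m' assume *: "m \<in> monomials X" "m' \<in> monomials X" "prod_mset m = prod_mset m'" "m \<noteq> m'"
  have "(\<Sum>k\<in>{m, m'}. (if k = m then 1 else - 1) *\<^sub>R prod_mset k) \<in> E"
    using * by (intro polynomial_in_E) auto
  then show False using * zero by simp
qed

text \<open>
  A linear combination of values of monomials is a combination of the monomials themselves, since
  distinct monomials have distinct values; so it is trivial or it lies in \<open>E\<close>.
\<close>

lemma combination_of_monomials:
  assumes "finite S" "S \<subseteq> prod_mset ` monomials X"
  shows "(\<forall>v\<in>S. u v = 0) \<or> (\<Sum>v\<in>S. u v *\<^sub>R v) \<in> E"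
proof (cases "\<forall>v\<in>S. u v = 0")
  case False
  define M where "M = {m \<in> monomials X. prod_mset m \<in> {v \<in> S. u v \<noteq> 0}}"
  have inj: "inj_on prod_mset M"
    using inj_on_prod_mset_monomials by (rule inj_on_subset) (auto simp: M_def)
  have image: "prod_mset ` M = {v \<in> S. u v \<noteq> 0}"
    using assms(2) by (auto simp: M_def)
  have "(\<Sum>v\<in>S. u v *\<^sub>R v) = (\<Sum>v\<in>prod_mset ` M. u v *\<^sub>R v)"
    unfolding image using assms(1) by (intro sum.mono_neutral_right) auto
  also have "\<dots> = (\<Sum>m\<in>M. u (prod_mset m) *\<^sub>R prod_mset m)"
    by (simp add: sum.reindex[OF inj])
  also have "\<dots> \<in> E"
  proof (rule polynomial_in_E)
    show "finite M"
      using assms(1) by (intro finite_imageD[OF _ inj]) (simp add: image)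
    show "M \<noteq> {}" using False image by blast
  qed (auto simp: M_def)
  finally show ?thesis ..
qed simp

lemma independent_monomials: "independent (prod_mset ` monomials X)"
  unfolding independent_explicit_finite_subsets
  using combination_of_monomials zero by metis

lemma hull_subset_E: "real_subalgebra hull X \<subseteq> E \<union> {0}"
proof
  fix y assume "y \<in> real_subalgebra hull X"
  then obtain S u where S: "finite S" "S \<subseteq> prod_mset ` monomials X" "y = (\<Sum>v\<in>S. u v *\<^sub>R v)"
    unfolding hull_eq_span_monomials span_explicit by blast
  then show "y \<in> E \<union> {0}"
    using combination_of_monomials[OF S(1,2), of u] by auto
qed

text \<open>
  Exponent maps over variable indices translate injectively into multisets of elements of \<open>X\<close>, so
  evaluating a polynomial yields a linear combination of monomials with the same coefficients.
\<close>

lemma free_generators_X: "free_generators X"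
  unfolding free_generators_def
proof (intro allI impI)
  fix n x P
  assume "inj_on x {..<n} \<and> x ` {..<n} \<subseteq> X \<and> polynomial_in n P \<and> P \<noteq> 0 \<and>
    Poly_Mapping.lookup P 0 = 0"
  then have x: "inj_on x {..<n}" "x ` {..<n} \<subseteq> X" and P: "polynomial_in n P" "P \<noteq> 0"
    "Poly_Mapping.lookup P 0 = 0" by auto
  define mset_of where "mset_of m = Abs_multiset (Poly_Mapping.lookup m)" for m :: "nat \<Rightarrow>\<^sub>0 nat"
  have count: "count (mset_of m) = Poly_Mapping.lookup m" for m
    unfolding mset_of_def by (rule count_Abs_multiset) simp
  have set: "set_mset (mset_of m) = Poly_Mapping.keys m" for m
    by (auto simp: set_mset_def count in_keys_iff)
  have "inj mset_of"
    by (rule injI) (metis count poly_mapping_eqI)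
  have keys: "Poly_Mapping.keys m \<subseteq> {..<n}" if "m \<in> Poly_Mapping.keys P" for m
    using P(1) that by (auto simp: polynomial_in_def)
  define \<mu> where "\<mu> m = image_mset x (mset_of m)" for m
  have inj: "inj_on \<mu> (Poly_Mapping.keys P)"
    unfolding \<mu>_def comp_def[symmetric]
  proof (rule comp_inj_on)
    show "inj_on (image_mset x) (mset_of ` Poly_Mapping.keys P)"
      using inj_on_image_mset[OF x(1)] by (rule inj_on_subset) (use keys set in auto)
  qed (use \<open>inj mset_of\<close> inj_on_subset in blast)
  define c where "c = Poly_Mapping.lookup P \<circ> the_inv_into (Poly_Mapping.keys P) \<mu>"
  have c: "c (\<mu> m) = Poly_Mapping.lookup P m" if "m \<in> Poly_Mapping.keys P" for m
    using that inj by (simp add: c_def the_inv_into_f_f)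
  have "eval_polynomial P x = (\<Sum>m\<in>\<mu> ` Poly_Mapping.keys P. c m *\<^sub>R prod_mset m)"
    unfolding eval_polynomial_def sum.reindex[OF inj]
    by (intro sum.cong refl)
      (simp add: c[unfolded \<mu>_def] \<mu>_def image_prod_mset_multiplicity set count)
  also have "\<dots> \<in> E"
  proof (rule polynomial_in_E)
    show "\<mu> ` Poly_Mapping.keys P \<noteq> {}" using P(2) by simp
    show "\<mu> ` Poly_Mapping.keys P \<subseteq> monomials X"
    proof
      fix m' assume "m' \<in> \<mu> ` Poly_Mapping.keys P"
      then obtain m where m: "m \<in> Poly_Mapping.keys P" "m' = \<mu> m" by blast
      then have "m \<noteq> 0" using P(3) by (auto simp: in_keys_iff)
      then have "mset_of m \<noteq> {#}"
        by (metis set keys_eq_empty set_mset_empty)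
      moreover have "set_mset m' \<subseteq> X"
        using keys[OF m(1)] x(2) by (auto simp: m(2) \<mu>_def set)
      ultimately show "m' \<in> monomials X" by (simp add: monomials_def m(2) \<mu>_def)
    qed
    show "c m \<noteq> 0" if "m \<in> \<mu> ` Poly_Mapping.keys P" for m
      using that c by (auto simp: in_keys_iff)
  qed simp
  finally show "eval_polynomial P x \<noteq> 0" using zero by metis
qed

text \<open>
  If a proper subset \<open>Z\<close> generated the algebra, some \<open>x\<close> outside \<open>Z\<close> would be a combination
  of monomials in \<open>Z\<close>, all different from the monomial \<open>x\<close>, against the independence of monomials.
\<close>

lemma minimal_generators_hull: "minimal_generators X (real_subalgebra hull X)"
  unfolding minimal_generators_def
proof (intro conjI allI impI notI refl)
  fix Z assume "Z \<subset> X" and eq: "real_subalgebra hull Z = real_subalgebra hull X"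
  then obtain x where x: "x \<in> X" "x \<notin> Z" by blast
  have mx: "{#x#} \<in> monomials X" using x by (simp add: monomials_def)
  have Z: "monomials Z \<subseteq> monomials X - {{#x#}}"
    using \<open>Z \<subset> X\<close> x by (auto simp: monomials_def)
  have "prod_mset ` monomials Z \<subseteq> prod_mset ` monomials X - {x}"
  proof
    fix y assume "y \<in> prod_mset ` monomials Z"
    then obtain m where m: "m \<in> monomials Z" "y = prod_mset m" by blast
    then have "prod_mset m \<noteq> prod_mset {#x#}"
      using Z mx inj_onD[OF inj_on_prod_mset_monomials, of m "{#x#}"] by blast
    then show "y \<in> prod_mset ` monomials X - {x}" using m Z by auto
  qed
  then have "span (prod_mset ` monomials Z) \<subseteq> span (prod_mset ` monomials X - {x})"
    by (rule span_mono)
  moreover have "x \<in> span (prod_mset ` monomials Z)"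
    using hull_inc[OF x(1), of real_subalgebra] eq by (simp add: hull_eq_span_monomials)
  moreover have "x \<in> prod_mset ` monomials X"
    using mx by (intro image_eqI[of _ _ "{#x#}"]) auto
  ultimately have "dependent (prod_mset ` monomials X)"
    unfolding dependent_def by blast
  then show False using independent_monomials by blast
qed

lemma independent_X: "independent X"
proof (rule independent_mono[OF independent_monomials])
  show "X \<subseteq> prod_mset ` monomials X"
  proof
    fix x assume "x \<in> X"
    then show "x \<in> prod_mset ` monomials X"
      by (intro image_eqI[of _ _ "{#x#}"]) (auto simp: monomials_def)
  qed
qed

lemma strongly_algebrable_if_nonzero_polynomials_in:
  fixes \<kappa> :: "'k rel"
  assumes "|X| =o \<kappa>"
  shows "strongly_algebrable \<kappa> E"
  unfolding strongly_algebrable_def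
  using assms real_subalgebra_hull hull_subset_E free_generators_X by blast

lemma algebrable_if_nonzero_polynomials_in:
  fixes \<kappa> :: "'k rel"
  assumes "|X| =o \<kappa>"
  shows "algebrable \<kappa> E"
  unfolding algebrable_def
  using assms real_subalgebra_hull hull_subset_E minimal_generators_hull by blast

lemma lineable_if_nonzero_polynomials_in:
  fixes \<kappa> :: "'k rel"
  assumes "|X| =o \<kappa>"
  shows "lineable \<kappa> E"
proof -
  have "span X \<subseteq> real_subalgebra hull X"
    using real_subalgebra_hull[of X] by (intro span_minimal hull_subset) (simp add: real_subalgebra_def)
  then have "span X \<subseteq> E \<union> {0}"
    using hull_subset_E by blast
  moreover have "has_dimension (span X) \<kappa>"
    unfolding has_dimension_def using independent_X assms by blast
  ultimately show ?thesis
    unfolding lineable_def using subspace_span by blast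
qed

end

section \<open>Sierpinski-Zygmund functions and almost disjoint families\<close>

lemma zero_notin_Sierpinski_Zygmund: "0 \<notin> Sierpinski_Zygmund"
proof
  assume "(0 :: real \<Rightarrow> real) \<in> Sierpinski_Zygmund"
  moreover have "(0 :: real \<Rightarrow> real) \<in> borel_measurable (restrict_space borel UNIV)"
    by (simp add: zero_fun_def)
  ultimately show False
    unfolding Sierpinski_Zygmund_def using card_of_refl by blast
qed

text \<open>
  The graphs of two functions in \<open>V\<close> meet exactly over the zeros of their difference, and a
  Sierpinski-Zygmund function has fewer than continuum many zeros, being Borel on its zero set. A
  bijection of the plane with the line moves the graphs into \<open>\<real>\<close>.
\<close>

lemma almost_disjoint_graphs:
  assumes "subspace V" "V \<subseteq> Sierpinski_Zygmund \<union> {0}" "B \<subseteq> V"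
  shows "\<exists>F. almost_disjoint_family (UNIV :: real set) F \<and> |F| =o |B|"
proof -
  have inf: "infinite (UNIV :: real set)" by (rule infinite_UNIV_char_0)
  have "|UNIV \<times> UNIV :: (real \<times> real) set| =o continuum"
    by (rule card_of_Times_same_infinite[OF inf])
  then obtain \<phi> :: "real \<times> real \<Rightarrow> real" where "bij_betw \<phi> (UNIV \<times> UNIV) UNIV"
    unfolding card_of_ordIso[symmetric] by blast
  then have \<phi>: "inj \<phi>" by (simp add: bij_betw_def)
  define \<Gamma> where "\<Gamma> f = range (\<lambda>x. \<phi> (x, f x))" for f :: "real \<Rightarrow> real"
  have "|\<Gamma> f| =o continuum" for f
  proof -
    have "inj (\<lambda>x. \<phi> (x, f x))" by (auto intro!: injI dest: injD[OF \<phi>])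
    then have "bij_betw (\<lambda>x. \<phi> (x, f x)) UNIV (\<Gamma> f)"
      by (simp add: \<Gamma>_def bij_betw_def)
    then show ?thesis
      by (intro ordIso_symmetric[OF card_of_ordIsoI])
  qed
  moreover have small: "|\<Gamma> f \<inter> \<Gamma> g| <o continuum" if "f \<in> B" "g \<in> B" "f \<noteq> g" for f g
  proof -
    define Z where "Z = {x. (f - g) x = 0}"
    have "f - g \<in> V"
      using assms that by (intro subspace_diff) auto
    moreover have "f - g \<noteq> 0" using that by simp
    ultimately have "f - g \<in> Sierpinski_Zygmund" using assms(2) by blast
    moreover have "f - g \<in> borel_measurable (restrict_space borel Z)"
    proof -
      have "(\<lambda>_. 0 :: real) \<in> borel_measurable (restrict_space borel Z)" by simp
      then show ?thesis
        by (rule measurable_cong[THEN iffD1, rotated]) (simp add: space_restrict_space Z_def)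
    qed
    ultimately have "\<not> |Z| =o continuum"
      by (auto simp: Sierpinski_Zygmund_def)
    then have "|Z| <o continuum"
      using card_of_mono1[OF subset_UNIV, of Z] by (simp add: ordLeq_iff_ordLess_or_ordIso)
    moreover have "\<Gamma> f \<inter> \<Gamma> g \<subseteq> (\<lambda>x. \<phi> (x, f x)) ` Z"
      by (auto simp: \<Gamma>_def Z_def dest!: injD[OF \<phi>])
    then have "|\<Gamma> f \<inter> \<Gamma> g| \<le>o |Z|"
      by (rule ordLeq_transitive[OF card_of_mono1 card_of_image])
    ultimately show ?thesis by (rule ordLeq_ordLess_trans[rotated])
  qed
  ultimately have "almost_disjoint_family UNIV (\<Gamma> ` B)"
    unfolding almost_disjoint_family_def by auto
  moreover have "inj_on \<Gamma> B"
  proof (rule inj_onI, rule ccontr)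
    fix f g assume *: "f \<in> B" "g \<in> B" "\<Gamma> f = \<Gamma> g" "f \<noteq> g"
    then have "|\<Gamma> g| <o continuum" using small[of f g] by simp
    then show False using \<open>|\<Gamma> g| =o continuum\<close> not_ordLess_ordIso by metis
  qed
  then have "|\<Gamma> ` B| =o |B|"
    by (rule ordIso_symmetric[OF card_of_ordIsoI[OF inj_on_imp_bij_betw]])
  ultimately show ?thesis by (intro exI conjI)
qed

lemma countable_ordLess_continuum:
  assumes "countable A"
  shows "|A| <o continuum"
proof (rule ccontr)
  assume "\<not> |A| <o continuum"
  then have "continuum \<le>o |A|"
    using ordLess_or_ordLeq[OF card_of_Well_order card_of_Well_order] by blast
  then obtain f :: "real \<Rightarrow> 'a" where "inj f" "range f \<subseteq> A"
    unfolding card_of_ordLeq[symmetric] by blast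
  then have "countable (UNIV :: real set)"
    using assms countable_subset countable_image_inj_on by metis
  then show False using uncountable_UNIV_real by blast
qed

lemma card_of_UN_ordLess_finite:
  assumes "infinite C" "finite I" "\<And>i. i \<in> I \<Longrightarrow> |A i| <o |C|"
  shows "|\<Union>i\<in>I. A i| <o |C|"
  using assms(2,3)
proof (induction I)
  case empty
  show ?case by (simp add: card_of_finite_ordLess_infinite assms(1))
next
  case (insert i I)
  then show ?case
    by (simp add: card_of_Un_ordLess_infinite assms(1))
qed

lemma prod_mset_image_apply:
  fixes f :: "'a \<Rightarrow> 'b \<Rightarrow> real"
  shows "prod_mset (image_mset f m) x = prod_mset (image_mset (\<lambda>A. f A x) m)"
  by (induction m) simp_all

lemma sum_fun_apply: "(\<Sum>i\<in>I. f i) x = (\<Sum>i\<in>I. f i x :: real)"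
  by (induction I rule: infinite_finite_induct) simp_all

text \<open>
  A polynomial without constant term remains nonzero after subtracting the constant \<open>s\<close>, and its
  coefficients are still in \<open>S\<close>, so it does not vanish at distinct elements of \<open>T\<close>. These elements
  are presented through an injective assignment \<open>y\<close> to the variables in \<open>B\<close>.
\<close>

lemma algebraically_independent_over_avoids:
  fixes y :: "'b \<Rightarrow> 'a::field"
  assumes T: "algebraically_independent_over S T"
    and M: "finite M" "M \<noteq> {}" "M \<subseteq> monomials B"
    and y: "inj_on y B" "y ` B \<subseteq> T"
    and c: "\<And>m. m \<in> M \<Longrightarrow> c m \<in> S \<and> c m \<noteq> 0" and s: "- s \<in> S"
  shows "(\<Sum>m\<in>M. c m * prod_mset (image_mset y m)) \<noteq> s"
proof
  assume eq: "(\<Sum>m\<in>M. c m * prod_mset (image_mset y m)) = s"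
  have inj: "inj_on (image_mset y) M"
    using inj_on_image_mset[OF y(1)] by (rule inj_on_subset) (use M in \<open>auto simp: monomials_def\<close>)
  \<comment> \<open>the coefficients of the difference; \<open>{#}\<close> is the constant monomial\<close>
  define c' where "c' k = (if k = {#} then - s else c (the_inv_into M (image_mset y) k))" for k
  have ne: "image_mset y m \<noteq> {#}" if "m \<in> M" for m
    using that M by (auto simp: monomials_def)
  have c': "c' (image_mset y m) = c m" if "m \<in> M" for m
    using that ne inj by (simp add: c'_def the_inv_into_f_f)
  define N where "N = image_mset y ` M"
  have sum: "(\<Sum>k\<in>N. c' k * prod_mset k) = s"
    unfolding N_def sum.reindex[OF inj] eq[symmetric] by (intro sum.cong refl) (simp add: c')
  have N: "finite N" "N \<noteq> {}" "{#} \<notin> N"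
    using M ne by (auto simp: N_def)
  have good: "set_mset k \<subseteq> T \<and> c' k \<in> S \<and> c' k \<noteq> 0" if "k \<in> N" for k
  proof -
    obtain m where m: "m \<in> M" "k = image_mset y m" using \<open>k \<in> N\<close> by (auto simp: N_def)
    then have "set_mset k \<subseteq> T" using M y by (auto simp: monomials_def)
    then show ?thesis using c[OF m(1)] c'[OF m(1)] m by simp
  qed
  show False
  proof (cases "s = 0")
    case True
    then show ?thesis
      using T N good sum unfolding algebraically_independent_over_def by metis
  next
    case False
    have empty: "c' {#} = - s" by (simp add: c'_def)
    then have "(\<Sum>k\<in>insert {#} N. c' k * prod_mset k) = 0"
      using N sum by simp
    moreover have "set_mset k \<subseteq> T \<and> c' k \<in> S \<and> c' k \<noteq> 0" if "k \<in> insert {#} N" for k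
      using that good s False empty by auto
    ultimately show ?thesis
      using T N unfolding algebraically_independent_over_def
      by (metis finite_insert insert_not_empty)
  qed
qed

text \<open>
  The functions \<open>f A\<close>, for \<open>A \<in> F\<close>, diagonalise against all partial Borel functions at once. Given a
  polynomial and some \<open>g \<eta>\<close>, the values \<open>f A \<xi>\<close> come from a set that is independent over all
  parameters involved as soon as \<open>\<eta>\<close> and the coefficients are at most \<open>\<xi>\<close> in the well-order
  \<open>continuum\<close> of the reals. As \<open>F\<close> is almost disjoint, distinct \<open>A\<close> and \<open>B\<close> select different elements
  of this set for all but fewer than continuum many \<open>\<xi>\<close>.
\<close>

lemma ex_polynomials_in_Sierpinski_Zygmund:
  assumes "almost_disjoint_family (UNIV :: real set) F"
  shows "\<exists>X. |X| =o |F| \<and> nonzero_polynomials_in X Sierpinski_Zygmund"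
proof -
  have inf: "infinite (UNIV :: real set)" by (rule infinite_UNIV_char_0)
  have card_F: "|A| =o continuum" if "A \<in> F" for A
    using assms that by (simp add: almost_disjoint_family_def)
  have disj: "|A \<inter> B| <o continuum" if "A \<in> F" "B \<in> F" "A \<noteq> B" for A B
    using assms that by (simp add: almost_disjoint_family_def)
  have total: "x = y \<or> (x, y) \<in> continuum \<or> (y, x) \<in> continuum" for x y :: real
    using card_of_Well_order[of "UNIV :: real set"]
    by (auto simp: well_order_on_def linear_order_on_def total_on_def Field_card_of)
  have refl: "(x, x) \<in> continuum" for x :: real
    using card_of_Well_order[of "UNIV :: real set"]
    by (auto simp: well_order_on_def linear_order_on_def partial_order_on_def preorder_on_def
        refl_on_def Field_card_of)
  have underS: "|underS continuum x| <o continuum" for x :: real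
    by (rule card_of_underS[OF card_of_Card_order]) (simp add: Field_card_of)
  have under: "under continuum x = insert x (underS continuum x)" for x :: real
    using refl by (auto simp: under_def underS_def)
  have singleton: "|{x}| <o continuum" for x :: real
    using inf by (simp add: card_of_finite_ordLess_infinite)
  have under_small: "|under continuum x| <o continuum" for x :: real
    unfolding under insert_is_Un[of x "underS _ _"]
    by (intro card_of_Un_ordLess_infinite inf singleton underS)
  obtain g :: "real \<Rightarrow> real \<Rightarrow> real" where g:
    "\<And>Z f. f \<in> borel_measurable (restrict_space borel Z) \<Longrightarrow> \<exists>\<eta>. \<forall>z\<in>Z. f z = g \<eta> z"
    using ex_universal_partial_borel by blast
  \<comment> \<open>the rationals only make \<open>S \<xi>\<close> infinite; the sign is that of a constant term moved to the left\<close>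
  define S where "S \<xi> = \<rat> \<union> (under continuum \<xi> \<union> (\<lambda>\<eta>. - g \<eta> \<xi>) ` under continuum \<xi>)" for \<xi>
  have "\<exists>T. algebraically_independent_over (S \<xi>) T \<and> |T| =o continuum" for \<xi>
  proof (rule ex_algebraically_independent_over)
    show "infinite (S \<xi>)"
      unfolding S_def by (simp add: Rats_infinite)
    have "|\<rat> :: real set| <o continuum"
      by (rule countable_ordLess_continuum[OF countable_rat])
    moreover have "|(\<lambda>\<eta>. - g \<eta> \<xi>) ` under continuum \<xi>| <o continuum"
      by (rule ordLeq_ordLess_trans[OF card_of_image under_small])
    ultimately show "|S \<xi>| <o continuum"
      unfolding S_def by (intro card_of_Un_ordLess_infinite inf under_small)
  qed
  then obtain T where T: "\<And>\<xi>. algebraically_independent_over (S \<xi>) (T \<xi>)"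
    and card_T: "\<And>\<xi>. |T \<xi>| =o continuum"
    by metis
  have "\<exists>b. bij_betw b (UNIV :: real set) (T \<xi>)" for \<xi>
    unfolding card_of_ordIso by (rule ordIso_symmetric[OF card_T])
  then have "\<forall>\<xi>. \<exists>b. bij_betw b (UNIV :: real set) (T \<xi>)" by blast
  then obtain t where "\<forall>\<xi>. bij_betw (t \<xi>) (UNIV :: real set) (T \<xi>)" by (rule choice[THEN exE])
  then have t: "bij_betw (t \<xi>) UNIV (T \<xi>)" for \<xi> by blast
  have "\<exists>b. bij_betw b (UNIV :: real set) A" if "A \<in> F" for A
    unfolding card_of_ordIso by (rule ordIso_symmetric[OF card_F[OF that]])
  then have "\<forall>A\<in>F. \<exists>b. bij_betw b (UNIV :: real set) A" by blast
  then obtain h where "\<forall>A\<in>F. bij_betw (h A) (UNIV :: real set) A" by (rule bchoice[THEN exE])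
  then have h: "bij_betw (h A) UNIV A" if "A \<in> F" for A using that by blast
  have agree: "|{\<xi>. h A \<xi> = h B \<xi>}| <o continuum" if "A \<in> F" "B \<in> F" "A \<noteq> B" for A B
  proof -
    have "inj_on (h A) {\<xi>. h A \<xi> = h B \<xi>}"
      using h[OF that(1)] by (auto simp: bij_betw_def intro: inj_on_subset)
    moreover have "h A ` {\<xi>. h A \<xi> = h B \<xi>} \<subseteq> A \<inter> B"
      using bij_betwE[OF h[OF that(1)]] bij_betwE[OF h[OF that(2)]] by auto metis
    ultimately have "|{\<xi>. h A \<xi> = h B \<xi>}| \<le>o |A \<inter> B|"
      unfolding card_of_ordLeq[symmetric] by (intro exI conjI)
    then show ?thesis using disj[OF that] by (rule ordLeq_ordLess_trans)
  qed
  define f where "f A \<xi> = t \<xi> (h A \<xi>)" for A \<xi>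
  have SZ: "(\<Sum>m\<in>M. c m *\<^sub>R prod_mset (image_mset f m)) \<in> Sierpinski_Zygmund" (is "?P \<in> _")
    if M: "finite M" "M \<noteq> {}" "M \<subseteq> monomials F" and c: "\<And>m. m \<in> M \<Longrightarrow> c m \<noteq> 0" for M c
    unfolding Sierpinski_Zygmund_def
  proof (intro CollectI allI impI notI)
    fix Z :: "real set"
    assume Z: "|Z| =o continuum" and "?P \<in> borel_measurable (restrict_space borel Z)"
    then obtain \<eta> where \<eta>: "\<And>z. z \<in> Z \<Longrightarrow> ?P z = g \<eta> z" using g by blast
    define \<B> where "\<B> = (\<Union>m\<in>M. set_mset m)"
    have \<B>: "finite \<B>" "\<B> \<subseteq> F" using M by (auto simp: \<B>_def monomials_def)
    \<comment> \<open>the points where some coefficient or \<open>\<eta>\<close> comes later, or where two variables coincide\<close>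
    define Bad where "Bad = (\<Union>m\<in>M. underS continuum (c m)) \<union> (underS continuum \<eta> \<union>
      (\<Union>(A, B)\<in>{(A, B) \<in> \<B> \<times> \<B>. A \<noteq> B}. {\<xi>. h A \<xi> = h B \<xi>}))"
    have pairs: "|\<Union>(A, B)\<in>{(A, B) \<in> \<B> \<times> \<B>. A \<noteq> B}. {\<xi>. h A \<xi> = h B \<xi>}| <o continuum"
    proof (rule card_of_UN_ordLess_finite[OF inf])
      show "finite {(A, B) \<in> \<B> \<times> \<B>. A \<noteq> B}"
        using \<B> by (intro finite_subset[OF _ finite_cartesian_product[of \<B> \<B>]]) auto
    qed (use agree \<B> in auto)
    have "|Bad| <o continuum"
      unfolding Bad_def
      by (intro card_of_Un_ordLess_infinite[OF inf] card_of_UN_ordLess_finite[OF inf M(1)] pairs underS)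
    then have "|Bad| <o |Z|"
      using ordIso_symmetric[OF Z] by (rule ordLess_ordIso_trans)
    then have "\<not> Z \<subseteq> Bad"
      by (metis card_of_mono1 not_ordLess_ordLeq)
    then obtain \<xi> where \<xi>: "\<xi> \<in> Z" "\<xi> \<notin> Bad" by blast
    have under: "x \<in> under continuum \<xi>" if "\<xi> \<notin> underS continuum x" for x
      using that total[of x \<xi>] refl by (auto simp: under_def underS_def)
    have "(\<Sum>m\<in>M. c m * prod_mset (image_mset (\<lambda>A. f A \<xi>) m)) \<noteq> g \<eta> \<xi>"
    proof (rule algebraically_independent_over_avoids[OF T M(1,2)])
      show "M \<subseteq> monomials \<B>" using M by (auto simp: \<B>_def monomials_def)
      show "inj_on (\<lambda>A. f A \<xi>) \<B>"
      proof (rule inj_onI, rule ccontr)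
        fix A B assume *: "A \<in> \<B>" "B \<in> \<B>" "f A \<xi> = f B \<xi>" "A \<noteq> B"
        then have "h A \<xi> = h B \<xi>"
          using t[of \<xi>] by (simp add: f_def bij_betw_def inj_eq)
        then show False using * \<xi> by (auto simp: Bad_def)
      qed
      show "(\<lambda>A. f A \<xi>) ` \<B> \<subseteq> T \<xi>"
        using t[of \<xi>] by (auto simp: f_def bij_betw_def)
      show "c m \<in> S \<xi> \<and> c m \<noteq> 0" if "m \<in> M" for m
        using that c \<xi> under[of "c m"] by (auto simp: S_def Bad_def)
      show "- g \<eta> \<xi> \<in> S \<xi>"
        using \<xi> under[of \<eta>] by (auto simp: S_def Bad_def)
    qed
    moreover have "?P \<xi> = (\<Sum>m\<in>M. c m * prod_mset (image_mset (\<lambda>A. f A \<xi>) m))"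
      by (simp add: sum_fun_apply scaleR_fun_def prod_mset_image_apply)
    ultimately show False using \<eta>[OF \<xi>(1)] by simp
  qed
  have inj: "inj_on f F"
  proof (rule inj_onI, rule ccontr)
    fix A B assume *: "A \<in> F" "B \<in> F" "f A = f B" "A \<noteq> B"
    have "(\<Sum>m\<in>{{#A#}, {#B#}}. (if m = {#A#} then 1 else - 1) *\<^sub>R prod_mset (image_mset f m))
        \<in> Sierpinski_Zygmund"
      using * by (intro SZ) (auto simp: monomials_def)
    then show False using * zero_notin_Sierpinski_Zygmund by simp
  qed
  have "nonzero_polynomials_in (f ` F) Sierpinski_Zygmund"
    unfolding nonzero_polynomials_in_def
  proof (intro allI impI)
    fix M and c :: "(real \<Rightarrow> real) multiset \<Rightarrow> real"
    assume *: "finite M \<and> M \<noteq> {} \<and> M \<subseteq> monomials (f ` F) \<and> (\<forall>m\<in>M. c m \<noteq> 0)"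
    \<comment> \<open>pull the monomials in the functions \<open>f A\<close> back to monomials in the index sets \<open>A\<close>\<close>
    define N where "N = {m \<in> monomials F. image_mset f m \<in> M}"
    have injN: "inj_on (image_mset f) N"
      using inj_on_image_mset[OF inj] by (rule inj_on_subset) (auto simp: N_def monomials_def)
    have image: "image_mset f ` N = M"
    proof
      show "M \<subseteq> image_mset f ` N"
      proof
        fix m assume m: "m \<in> M"
        define k where "k = image_mset (the_inv_into F f) m"
        have mF: "m \<noteq> {#}" "set_mset m \<subseteq> f ` F" using * m by (auto simp: monomials_def)
        have "image_mset f k = image_mset id m"
          unfolding k_def multiset.map_comp
          using mF inj by (intro image_mset_cong) (auto simp: f_the_inv_into_f)
        moreover have "k \<in> monomials F"
          using mF inj by (auto simp: k_def monomials_def the_inv_into_f_f)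
        ultimately show "m \<in> image_mset f ` N" using m by (force simp: N_def)
      qed
    qed (auto simp: N_def)
    have "(\<Sum>m\<in>N. c (image_mset f m) *\<^sub>R prod_mset (image_mset f m)) \<in> Sierpinski_Zygmund"
    proof (rule SZ)
      show "finite N"
        using * by (intro finite_imageD[OF _ injN]) (simp add: image)
      show "N \<noteq> {}" using * image by blast
    qed (use * in \<open>auto simp: N_def\<close>)
    also have "(\<Sum>m\<in>N. c (image_mset f m) *\<^sub>R prod_mset (image_mset f m)) =
        (\<Sum>m\<in>M. c m *\<^sub>R prod_mset m)"
      by (simp add: image[symmetric] sum.reindex[OF injN])
    finally show "(\<Sum>m\<in>M. c m *\<^sub>R prod_mset m) \<in> Sierpinski_Zygmund" .
  qed
  moreover have "|f ` F| =o |F|"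
    using inj by (rule ordIso_symmetric[OF card_of_ordIsoI[OF inj_on_imp_bij_betw]])
  ultimately show ?thesis by (intro exI conjI)
qed

theorem theorem2p2:
  fixes \<kappa> :: "'k rel"
  assumes "Card_order \<kappa>"
    and "continuum \<le>o \<kappa>"
    and "\<kappa> \<le>o ctwo ^c continuum"
  shows "(strongly_algebrable \<kappa> Sierpinski_Zygmund \<longleftrightarrow> algebrable \<kappa> Sierpinski_Zygmund) \<and>
    (algebrable \<kappa> Sierpinski_Zygmund \<longleftrightarrow> lineable \<kappa> Sierpinski_Zygmund) \<and>
    (lineable \<kappa> Sierpinski_Zygmund \<longleftrightarrow>
      (\<exists>F. almost_disjoint_family (Field continuum) F \<and> |F| =o \<kappa>))"
proof -
  let ?AD = "\<exists>F. almost_disjoint_family (Field continuum) F \<and> |F| =o \<kappa>"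
  have ADI: ?AD
    if V: "subspace V" "V \<subseteq> Sierpinski_Zygmund \<union> {0}" "B \<subseteq> V" and B: "|B| =o \<kappa>" for V B
  proof -
    obtain F where "almost_disjoint_family (UNIV :: real set) F" "|F| =o |B|"
      using almost_disjoint_graphs[OF V] by blast
    then show ?thesis
      using ordIso_transitive[OF _ B] by (auto simp: Field_card_of)
  qed
  have ?AD if "strongly_algebrable \<kappa> Sierpinski_Zygmund"
  proof -
    obtain A X where "real_subalgebra A" "A \<subseteq> Sierpinski_Zygmund \<union> {0}"
      "real_subalgebra hull X = A" "|X| =o \<kappa>"
      using \<open>strongly_algebrable \<kappa> Sierpinski_Zygmund\<close> unfolding strongly_algebrable_def by blast
    then show ?AD
      by (intro ADI[of A X]) (auto simp: real_subalgebra_def intro: hull_inc)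
  qed
  moreover have ?AD if "algebrable \<kappa> Sierpinski_Zygmund"
  proof -
    obtain A Z where "real_subalgebra A" "A \<subseteq> Sierpinski_Zygmund \<union> {0}"
      "minimal_generators Z A" "|Z| =o \<kappa>"
      using \<open>algebrable \<kappa> Sierpinski_Zygmund\<close> unfolding algebrable_def by blast
    then show ?AD
      by (intro ADI[of A Z]) (auto simp: real_subalgebra_def minimal_generators_def intro: hull_inc)
  qed
  moreover have ?AD if "lineable \<kappa> Sierpinski_Zygmund"
  proof -
    obtain V B where "subspace V" "V \<subseteq> Sierpinski_Zygmund \<union> {0}" "span B = V" "|B| =o \<kappa>"
      using \<open>lineable \<kappa> Sierpinski_Zygmund\<close> unfolding lineable_def has_dimension_def by blast
    then show ?AD
      by (intro ADI[of V B]) (auto intro: span_base)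
  qed
  moreover have "strongly_algebrable \<kappa> Sierpinski_Zygmund \<and>
    algebrable \<kappa> Sierpinski_Zygmund \<and> lineable \<kappa> Sierpinski_Zygmund" if ?AD
  proof -
    obtain F where F: "almost_disjoint_family (UNIV :: real set) F" "|F| =o \<kappa>"
      using \<open>?AD\<close> by (auto simp: Field_card_of)
    obtain X where X: "|X| =o |F|" "nonzero_polynomials_in X Sierpinski_Zygmund"
      using ex_polynomials_in_Sierpinski_Zygmund[OF F(1)] by blast
    have "|X| =o \<kappa>" using X(1) F(2) by (rule ordIso_transitive)
    then show ?thesis
      using X(2) zero_notin_Sierpinski_Zygmund
      by (intro conjI strongly_algebrable_if_nonzero_polynomials_in
          algebrable_if_nonzero_polynomials_in lineable_if_nonzero_polynomials_in)
  qed
  ultimately show ?thesis by blast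
qed

end
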